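(* All sets $V$ of speeds below are assumed to satisfy $\gcd(V)=1$. (i) For integers $5\le n\le45$, $r\in[n-1]$ and $n\le w\le 10n$, the set $([n-1]\setminus\{r\})\cup\{w\}$ is tight if and only if $(n,r,w)$ is one of the eleven triples \[ (5,2,7),\ (6,2,9),\ (8,6,12),\ (14,12,24),\ (20,18,36),\ (26,24,48), \] \[ (32,30,60),\ (32,30,90),\ (33,30,60),\ (38,36,72),\ (44,42,84). \] Moreover, each of the last nine triples has $w=mr$ for an integer $m\ge2$ and satisfies, with $s=n-r$, the criterion that $\gcd(r,b)>1$ for every $b\in\{s,s+1,\dots,ms-1\}$. (ii) For $6\le n\le34$, the only tight set of the form $([n-1]\setminus\{r_1,r_2\})\cup\{w_1,w_2\}$ with $r_1\ne r_2$ in $[n-1]$, $w_1\ne w_2$ and $n-1<w_1,w_2\le 4n$ is $\{1,4,5,6,7,11,13\}$, with $n=8$ (here $\{r_1,r_2\}=\{2,3\}$ and $\{w_1,w_2\}=\{11,13\}$); it is not an accelerated baseline, since neither $11$ nor $13$ is a multiple of $2$ or of $3$. (iii) For $4\le n\le16$, the tight sets of $n-1$ distinct positive integers with all speeds $<2n$ are exactly: the baseline $[n-1]$ for each such $n$; $\{1,3,4,7\}$ for $n=5$; $\{1,3,4,5,9\}$ for $n=6$; $\{1,2,3,4,5,7,12\}$ and $\{1,4,5,6,7,11,13\}$ for $n=8$; and $\{1,\dots,11,13,24\}$ for $n=14$. (iv) For $n\in\{14,15,16\}$, every set $V$ of $n-1$ distinct positive integers, all at most $2n-1$, satisfies $\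mathrm{LR}(V)\ge\frac1n$.
   Context: $\lVert x\rVert$ denotes the distance from the real number $x$ to the nearest integer, and $[n-1]=\{1,\dots,n-1\}$ (the baseline). For a set $V$ of $n-1$ distinct positive integers (called speeds), $\mathrm{LR}(V)=\max_{t\in[0,1)}\min_{v\in V}\lVert vt\rVert$, and $V$ is called tight if $\mathrm{LR}(V)=\frac1n$. An accelerated baseline is a set obtained from $[n-1]$ by replacing some speeds by multiples of themselves. *)

theory Defs
  imports "HOL-Analysis.Analysis"
begin

text \<open>
  \<open>dist_int x\<close> is the distance \<open>\<parallel>x\<parallel>\<close> to the nearest integer;
  \<open>round x\<close> is a nearest integer, ties being irrelevant here (see \<open>dist_int_le\<close>).
\<close>
definition dist_int :: "real \<Rightarrow> real" where
  "dist_int x = \<bar>x - of_int (round x)\<bar>"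

lemma dist_int_le: "dist_int x \<le> \<bar>x - of_int k\<bar>"
  unfolding dist_int_def by (rule round_diff_minimal)

definition min_dist :: "nat set \<Rightarrow> real \<Rightarrow> real" where
  "min_dist V t = (MIN v\<in>V. dist_int (real v * t))"

text \<open>The supremum is a maximum, see \<open>LR_attained\<close> and \<open>min_dist_le_LR\<close>.\<close>
definition LR :: "nat set \<Rightarrow> real" where
  "LR V = (SUP t\<in>{0..<1}. min_dist V t)"

definition speed_set :: "nat \<Rightarrow> nat set \<Rightarrow> bool" where
  "speed_set n V \<longleftrightarrow> finite V \<and> 0 \<notin> V \<and> card V + 1 = n"

definition tight :: "nat \<Rightarrow> nat set \<Rightarrow> bool" where
  "tight n V \<longleftrightarrow> speed_set n V \<and> LR V = 1 / real n"

definition baseline :: "nat \<Rightarrow> nat set" where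
  "baseline n = {1..n - 1}"

text \<open>
  The speed \<open>v\<close> of the baseline is replaced by its multiple \<open>f v\<close>, where \<open>f v = v\<close> means that
  it is kept. Bijectivity expresses that the result again consists of \<open>n - 1\<close> distinct speeds.
\<close>
definition accelerated_baseline :: "nat \<Rightarrow> nat set \<Rightarrow> bool" where
  "accelerated_baseline n V \<longleftrightarrow>
     0 \<notin> V \<and> (\<exists>f. bij_betw f (baseline n) V \<and> (\<forall>v\<in>baseline n. v dvd f v))"

lemma dist_int_eq_infdist: "dist_int x = infdist x \<int>"
proof (rule antisym)
  have ne: "(\<int> :: real set) \<noteq> {}" using Ints_0 by blast
  show "dist_int x \<le> infdist x \<int>"
    unfolding infdist_notempty[OF ne]
    by (rule cINF_greatest[OF ne]) (auto elim!: Ints_cases simp: dist_real_def dist_int_le)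
  show "infdist x \<int> \<le> dist_int x"
    unfolding dist_int_def using infdist_le[of "of_int (round x)" \<int> x] by (simp add: dist_real_def)
qed

lemma continuous_on_Min_image:
  fixes f :: "'a \<Rightarrow> 'b::topological_space \<Rightarrow> real"
  assumes "finite V" "V \<noteq> {}" "\<And>v. v \<in> V \<Longrightarrow> continuous_on S (f v)"
  shows "continuous_on S (\<lambda>t. MIN v\<in>V. f v t)"
  using assms
proof (induction V rule: finite_ne_induct)
  case (singleton v)
  then show ?case by simp
next
  case (insert v V)
  then have "continuous_on S (\<lambda>t. min (f v t) (MIN v\<in>V. f v t))"
    by (intro continuous_on_min) auto
  then show ?case using insert by simp
qed

lemma continuous_on_min_dist:
  assumes "finite V" "V \<noteq> {}"
  shows "continuous_on S (min_dist V)"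
  unfolding min_dist_def dist_int_eq_infdist
  using assms by (intro continuous_on_Min_image continuous_intros)

lemma min_dist_0_1: "min_dist V 1 = min_dist V 0"
  unfolding min_dist_def dist_int_def by simp

lemma min_dist_max_exists:
  assumes "finite V" "V \<noteq> {}"
  obtains t where "t \<in> {0..<1}" "\<And>u. u \<in> {0..1} \<Longrightarrow> min_dist V u \<le> min_dist V t"
proof -
  obtain t where t: "t \<in> {0..1}" "\<forall>u\<in>{0..1}. min_dist V u \<le> min_dist V t"
    using continuous_attains_sup[of "{0..1::real}" "min_dist V"] continuous_on_min_dist[OF assms]
    by auto
  show ?thesis
  proof (cases "t = 1")
    case True
    then show ?thesis using that[of 0] t by (simp add: min_dist_0_1)
  next
    case False
    then show ?thesis using that[of t] t by simp
  qed
qed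

lemma min_dist_le_LR:
  assumes "finite V" "V \<noteq> {}" "t \<in> {0..<1}"
  shows "min_dist V t \<le> LR V"
proof -
  obtain s where "\<And>u. u \<in> {0..1} \<Longrightarrow> min_dist V u \<le> min_dist V s"
    using min_dist_max_exists[OF assms(1,2)] by blast
  then have "bdd_above (min_dist V ` {0..<1})"
    by (intro bdd_aboveI2[where M = "min_dist V s"]) simp
  then show ?thesis unfolding LR_def using assms(3) by (intro cSUP_upper)
qed

lemma LR_attained:
  assumes "finite V" "V \<noteq> {}"
  shows "\<exists>t\<in>{0..<1}. LR V = min_dist V t"
proof -
  obtain t where t: "t \<in> {0..<1}" "\<And>u. u \<in> {0..1} \<Longrightarrow> min_dist V u \<le> min_dist V t"
    using min_dist_max_exists[OF assms] by blast
  then have "LR V \<le> min_dist V t"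
    unfolding LR_def by (intro cSUP_least) auto
  then show ?thesis using t(1) min_dist_le_LR[OF assms t(1)] by (intro bexI[of _ t]) auto
qed

end

theory Submission
  imports Defs "HOL-Number_Theory.Cong" "HOL-Library.Code_Binary_Nat"
begin

text \<open>
  For coprime \<open>c\<close> and \<open>q\<close> let \<open>p\<close> be inverse to \<open>c\<close> modulo \<open>q\<close>. At \<open>t = p / q\<close> a speed \<open>v\<close> lies within
  \<open>1 / n\<close> of the integers exactly if \<open>v\<close> is congruent to some \<open>\<plusminus>j * c\<close> with \<open>j \<le> q div n\<close>; call such a
  \<open>v\<close> a blocker of \<open>(q, c)\<close>. Hence a set with \<open>LR V \<le> 1 / n\<close> contains a blocker of every pair \<open>(q, c)\<close>,
  and all sets that are not tight are excluded by short searches for hitting sets: of size one or two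
  in parts (i) and (ii), where only pairs whose baseline blockers have been removed are of use, and of
  size \<open>n - 1\<close> in parts (iii) and (iv), where besides the tight sets only \<open>{2, 4, \<dots>, 2 * (n - 1)}\<close> survives.

  Tightness of an accelerated baseline with \<open>w = m * r\<close> follows from Dirichlet's approximation theorem:
  if no kept speed is close to an integer at \<open>t\<close>, then \<open>t\<close> is close to some \<open>a / r\<close> in lowest terms. The
  speed \<open>b \<in> {n - r..<n}\<close> with \<open>a * b \<equiv> \<plusminus>1\<close> modulo \<open>r\<close> is coprime to \<open>r\<close>, so \<open>b \<ge> m * (n - r)\<close> by the
  criterion, and since \<open>b\<close> is far from the integers at \<open>t\<close>, the distance from \<open>t\<close> to \<open>a / r\<close> is so small that
  \<open>m * r\<close> is close to an integer. The three tight sets which are not of this form are handled by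
  an explicit cover of the unit interval.
\<close>

section \<open>Bounds for the loneliness\<close>

lemma LR_gt:
  assumes "finite V" "V \<noteq> {}" "t \<in> {0..<1}" "\<And>v. v \<in> V \<Longrightarrow> x < dist_int (real v * t)"
  shows "x < LR V"
proof -
  have "x < min_dist V t"
    unfolding min_dist_def using assms by (subst Min_gr_iff) auto
  then show ?thesis using min_dist_le_LR[OF assms(1-3)] by linarith
qed

lemma LR_ge:
  assumes "finite V" "V \<noteq> {}" "t \<in> {0..<1}" "\<And>v. v \<in> V \<Longrightarrow> x \<le> dist_int (real v * t)"
  shows "x \<le> LR V"
proof -
  have "x \<le> min_dist V t"
    unfolding min_dist_def using assms by (subst Min_ge_iff) auto
  then show ?thesis using min_dist_le_LR[OF assms(1-3)] by linarith
qed

lemma LR_le: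
  assumes "finite V" "\<And>t. \<lbrakk>0 \<le> t; t < 1\<rbrakk> \<Longrightarrow> \<exists>v\<in>V. dist_int (real v * t) \<le> x"
  shows "LR V \<le> x"
proof -
  have "V \<noteq> {}" using assms(2)[of 0] by auto
  then obtain t where t: "t \<in> {0..<1}" "LR V = min_dist V t"
    using LR_attained assms(1) by blast
  with assms(2)[of t] obtain v where v: "v \<in> V" "dist_int (real v * t) \<le> x" by auto
  then have "min_dist V t \<le> dist_int (real v * t)"
    unfolding min_dist_def using assms(1) by simp
  with t v show ?thesis by linarith
qed

section \<open>Rational times and blockers\<close>

lemma dist_int_rational_le:
  fixes a b n q :: nat
  assumes "n > 0" "q > 0" "dist_int (real a * (real b / real q)) \<le> 1 / real n"
  obtains j where "j \<le> q div n" "[a * b = j] (mod q) \<or> [a * b + j = 0] (mod q)"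
proof -
  define k where "k = round (real a * (real b / real q))"
  define i where "i = int (a * b) - k * int q"
  have "\<bar>real a * (real b / real q) - k\<bar> = \<bar>real_of_int i\<bar> / q"
    using assms(2) by (simp add: i_def field_simps)
  with assms(3) have "\<bar>real_of_int i\<bar> / q \<le> 1 / n"
    by (simp add: dist_int_def k_def)
  with assms(1,2) have "real_of_int (\<bar>i\<bar> * int n) \<le> real_of_int (int q)"
    by (simp add: field_simps)
  then have "\<bar>i\<bar> * int n \<le> int q" by linarith
  then have "int (nat \<bar>i\<bar> * n) \<le> int q" by simp
  then have "nat \<bar>i\<bar> * n \<le> q" by linarith
  then have le: "nat \<bar>i\<bar> \<le> q div n"
    using assms(1) by (simp add: less_eq_div_iff_mult_less_eq)
  have "[int (a * b) = i] (mod int q)"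
    by (simp add: i_def cong_iff_dvd_diff)
  moreover from this have "[int (a * b) + int (nat \<bar>i\<bar>) = i + int (nat \<bar>i\<bar>)] (mod int q)"
    by (rule cong_add) simp
  ultimately have "[int (a * b) = int (nat \<bar>i\<bar>)] (mod int q) \<or> [int (a * b + nat \<bar>i\<bar>) = int 0] (mod int q)"
    by (cases "i < 0") simp_all
  then show ?thesis using that[OF le] unfolding cong_int_iff by blast
qed

text \<open>The second congruence expresses \<open>v = - j * c\<close> within the natural numbers;
  \<open>j = 0\<close> accounts for the multiples of \<open>q\<close>.\<close>

definition blocks :: "nat \<Rightarrow> nat \<Rightarrow> nat \<Rightarrow> nat \<Rightarrow> bool" where
  "blocks n q c v \<longleftrightarrow> (\<exists>j\<le>q div n. [v = j * c] (mod q) \<or> [v + j * c = 0] (mod q))"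

lemma exists_block:
  assumes "finite V" "V \<noteq> {}" "n > 0" "q > 0" "coprime c q" "LR V \<le> 1 / real n"
  shows "\<exists>v\<in>V. blocks n q c v"
proof (rule ccontr)
  assume no: "\<not> ?thesis"
  obtain p0 where p0: "[c * p0 = Suc 0] (mod q)" using cong_solve_coprime_nat assms(5) by blast
  define p where "p = p0 mod q"
  have p: "[c * p = 1] (mod q)" "p < q"
    using p0 assms(4) by (auto simp: p_def cong_def mod_mult_right_eq)
  have "1 / real n < LR V"
  proof (rule LR_gt[OF assms(1,2)])
    show "real p / real q \<in> {0..<1}" using p by simp
    fix v assume v: "v \<in> V"
    show "1 / real n < dist_int (real v * (real p / real q))"
    proof (rule ccontr)
      assume "\<not> ?thesis"
      then have "dist_int (real v * (real p / real q)) \<le> 1 / real n" by simp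
      from dist_int_rational_le[OF assms(3,4) this]
      obtain j where j: "j \<le> q div n" "[v * p = j] (mod q) \<or> [v * p + j = 0] (mod q)" .
      \<comment> \<open>Since \<open>c * p\<close> is 1 modulo \<open>q\<close>, multiplying by
        \<open>c\<close> turns the congruence for \<open>v * p\<close> into one for
        \<open>v\<close>.\<close>
      have v1: "[v * p * c = v] (mod q)"
        using cong_scalar_left[OF p(1), of v] by (simp add: mult_ac)
      have "[v = j * c] (mod q)" if "[v * p = j] (mod q)"
        using cong_trans[OF cong_sym[OF v1] cong_scalar_right[OF that, of c]] .
      moreover have "[v + j * c = 0] (mod q)" if "[v * p + j = 0] (mod q)"
        using cong_trans[OF cong_add[OF cong_sym[OF v1] cong_refl] cong_scalar_right[OF that, of c, unfolded distrib_right]]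
        by simp
      ultimately have "blocks n q c v" using j unfolding blocks_def by blast
      with no v show False by blast
    qed
  qed
  with assms(6) show False by simp
qed

section \<open>Diophantine approximation and accelerated baselines\<close>

lemma coprime_residue_exists:
  fixes a r e L :: int
  assumes "coprime a r" "r > 0"
  obtains b k where "L \<le> b" "b < L + r" "a * b = k * r + e"
proof -
  obtain x where x: "[a * x = 1] (mod r)" using cong_solve_coprime_int[OF assms(1)] by blast
  define b where "b = L + (x * e - L) mod r"
  have "[b = x * e] (mod r)" by (simp add: b_def cong_def mod_simps)
  then have "[a * b = a * (x * e)] (mod r)" by (rule cong_scalar_left)
  also have "[a * (x * e) = e] (mod r)" using cong_scalar_right[OF x, of e] by (simp add: mult_ac)
  finally have "r dvd a * b - e" by (simp add: cong_iff_dvd_diff)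
  then obtain k where "a * b - e = r * k" by (rule dvdE)
  then show ?thesis using that[of b k] assms(2) by (auto simp: b_def algebra_simps)
qed

text \<open>Choose \<open>b\<close> with \<open>a * b - k * r = e\<close>, where \<open>e\<close> is
  1 or -1 and opposite in sign to \<open>\<epsilon>\<close>. Then
  \<open>r * (b * t - k) = b * \<epsilon> + e\<close>, and for positive \<open>b\<close> the two
  terms counteract each other. The unit \<open>e\<close> also forces \<open>b\<close> and
  \<open>r\<close> to be coprime.\<close>

lemma coprime_approx_neighbour:
  fixes a r :: int and t \<epsilon> :: real
  assumes "coprime a r" "r > 0" "\<epsilon> = r * t - a"
  obtains b k :: int where "L \<le> b" "b < L + r" "coprime b r" "\<bar>b * t - k\<bar> = \<bar>b * \<bar>\<epsilon>\<bar> - 1\<bar> / r"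
proof -
  define e :: int where "e = (if \<epsilon> \<ge> 0 then -1 else 1)"
  obtain b k where b: "L \<le> b" "b < L + r" "a * b = k * r + e"
    using coprime_residue_exists[OF assms(1,2)] by metis
  have "is_unit e" by (simp add: e_def)
  have "coprime b r"
  proof (rule coprimeI)
    fix d assume "d dvd b" "d dvd r"
    then have "d dvd a * b - k * r" by (intro dvd_diff dvd_mult)
    with b(3) \<open>is_unit e\<close> show "is_unit d" by (metis add_diff_cancel_left' dvd_trans)
  qed
  moreover have "\<bar>b * t - k\<bar> = \<bar>b * \<bar>\<epsilon>\<bar> - 1\<bar> / r"
  proof -
    have "r * (b * t - k) = b * \<epsilon> + (a * b - k * r)"
      by (simp add: assms(3) algebra_simps)
    also have "real_of_int (a * b - k * r) = e" using b(3) by simp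
    finally have "r * (b * t - k) = b * \<epsilon> + e" by simp
    moreover have "b * \<epsilon> + e = (if \<epsilon> \<ge> 0 then b * \<bar>\<epsilon>\<bar> - 1 else - (b * \<bar>\<epsilon>\<bar> - 1))"
      by (simp add: e_def)
    ultimately have "\<bar>real_of_int r * (b * t - k)\<bar> = \<bar>b * \<bar>\<epsilon>\<bar> - 1\<bar>"
      by (simp only: abs_minus_cancel split: if_split) simp
    then show ?thesis using assms(2) by (simp add: abs_mult eq_divide_eq mult.commute)
  qed
  ultimately show ?thesis using that b by blast
qed

text \<open>Dirichlet's theorem allows the denominator \<open>k = n\<close>, which is not a baseline
  speed. A neighbour \<open>b\<close> below \<open>n\<close> then takes over:
  \<open>b * \<bar>\<epsilon>\<bar>\<close> lies between 0 and 1, so \<open>b * t\<close> is within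
  \<open>1 / n\<close> of an integer.\<close>

lemma Dirichlet_baseline:
  assumes "n \<ge> 2"
  obtains v a where "v \<in> {1..n - 1}" "\<bar>real v * t - of_int a\<bar> \<le> 1 / real n"
proof -
  obtain h k where hk: "coprime h k" "0 < k" "k \<le> int n" "\<bar>of_int k * t - of_int h\<bar> < 1 / n"
    using Dirichlet_approx_coprime[of n t] assms by auto
  show ?thesis
  proof (cases "k < int n")
    case True
    then show ?thesis using that[of "nat k" h] hk by (simp add: nat_le_iff le_nat_iff)
  next
    case False
    then have k: "k = int n" using hk by simp
    define \<epsilon> where "\<epsilon> = k * t - h"
    obtain b m :: int where b: "0 \<le> b" "b < 0 + k" "coprime b k" "\<bar>b * t - m\<bar> = \<bar>b * \<bar>\<epsilon>\<bar> - 1\<bar> / k"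
      using coprime_approx_neighbour[OF hk(1,2) \<epsilon>_def, of 0] by blast
    have "b \<noteq> 0" using b(3) k assms by auto
    have "b * \<bar>\<epsilon>\<bar> \<le> n * (1 / n)"
      using b(1,2) hk(4) k by (intro mult_mono) (auto simp: \<epsilon>_def)
    then have "\<bar>b * \<bar>\<epsilon>\<bar> - 1\<bar> \<le> 1" using assms b(1) by (simp add: abs_le_iff)
    then have "\<bar>b * t - m\<bar> \<le> 1 / n" using b(4) k by (simp add: divide_right_mono)
    then show ?thesis using that[of "nat b" m] b(1,2) k \<open>b \<noteq> 0\<close> by (simp add: nat_le_iff le_nat_iff)
  qed
qed

lemma dist_int_leI: "\<bar>x - of_int k\<bar> \<le> e \<Longrightarrow> dist_int x \<le> e"
  using dist_int_le[of x k] by linarith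

lemma exists_near_baseline:
  assumes "n \<ge> 2"
  shows "\<exists>v\<in>{1..n - 1}. dist_int (real v * t) \<le> 1 / real n"
  using Dirichlet_baseline[OF assms] dist_int_leI by metis

lemma exists_near_accelerated:
  assumes "2 \<le> r" "r < n" "V = {1..n - 1} - {r} \<union> {m * r}"
    and crit: "\<forall>b\<in>{n - r..m * (n - r) - 1}. gcd r b > 1"
  shows "\<exists>v\<in>V. dist_int (real v * t) \<le> 1 / real n"
proof -
  obtain v a where v: "v \<in> {1..n - 1}" "\<bar>real v * t - of_int a\<bar> \<le> 1 / real n"
    using Dirichlet_baseline[of n t] assms by auto
  show ?thesis
  proof (cases "v = r")
    case False
    then show ?thesis using v assms(3) dist_int_leI by (intro bexI[of _ v]) auto
  next
    case True
    define \<epsilon> where "\<epsilon> = real_of_int (int r) * t - a"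
    have eps: "\<bar>\<epsilon>\<bar> \<le> 1 / n" using v(2) True by (simp add: \<epsilon>_def)
    define g where "g = gcd a (int r)"
    show ?thesis
    proof (cases "g = 1")
      \<comment> \<open>If \<open>a / r\<close> is not in lowest terms, the reduced denominator
        \<open>r'\<close> is a smaller speed, hence kept, and it inherits the approximation.\<close>
      case False
      obtain r' a' where ra: "int r = g * r'" "a = g * a'"
        unfolding g_def by (meson dvdE gcd_dvd1 gcd_dvd2)
      have "g > 0" using assms(1) by (simp add: g_def)
      with False have g: "g \<ge> 2" by simp
      have "g * r' > 0" using ra(1) assms(1) by simp
      then have r': "r' > 0" using \<open>g > 0\<close> by (simp add: zero_less_mult_iff)
      have "r' < int r" using g r' ra(1) by simp
      have "\<epsilon> = g * (r' * t - a')" using ra by (simp add: \<epsilon>_def algebra_simps)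
      then have "real_of_int g * \<bar>r' * t - a'\<bar> \<le> 1 / n" using eps \<open>g > 0\<close> by (simp add: abs_mult)
      then have "\<bar>r' * t - a'\<bar> \<le> 1 / n"
        using g mult_right_mono[of 1 "real_of_int g" "\<bar>r' * t - a'\<bar>"] by simp
      then have "dist_int (real (nat r') * t) \<le> 1 / n" using r' by (intro dist_int_leI) simp
      then show ?thesis using r' \<open>r' < int r\<close> assms(2,3) by (intro bexI[of _ "nat r'"]) auto
    next
      case True
      then have "coprime a (int r)" by (simp add: g_def coprime_iff_gcd_eq_1)
      \<comment> \<open>The window starts at \<open>n - r\<close>, so that \<open>b\<close> is a
        speed below \<open>n\<close> and lies in the range where the criterion begins.\<close>
      then obtain b k :: int where b: "int n - int r \<le> b" "b < int n - int r + int r" "coprime b (int r)"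
          "\<bar>b * t - k\<bar> = \<bar>b * \<bar>\<epsilon>\<bar> - 1\<bar> / r"
        using coprime_approx_neighbour[OF _ _ \<epsilon>_def, of "int n - int r"] assms(1) by auto
      define b' where "b' = nat b"
      have b': "int b' = b" using b(1) assms(2) by (simp add: b'_def)
      have cop: "coprime b' r" using b(3) by (simp flip: b' add: coprime_int_iff)
      have "b' \<noteq> r" using cop assms(1) by auto
      have lt: "real b' * \<bar>\<epsilon>\<bar> \<le> 1"
      proof -
        have "real b' * \<bar>\<epsilon>\<bar> \<le> n * (1 / n)"
          using b(2) b' eps by (intro mult_mono) auto
        then show ?thesis using assms(2) by simp
      qed
      have eq: "\<bar>real b' * t - k\<bar> = (1 - real b' * \<bar>\<epsilon>\<bar>) / r"
        using b(4) lt by (simp flip: b')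
      show ?thesis
      proof (cases "(1 - real b' * \<bar>\<epsilon>\<bar>) / r \<le> 1 / n")
        case True
        then have "dist_int (real b' * t) \<le> 1 / n" using eq dist_int_leI[of "real b' * t" k] by simp
        moreover have "b' \<in> V" using b(1,2) b' \<open>b' \<noteq> r\<close> assms(2,3) by auto
        ultimately show ?thesis by blast
      next
        case False
        \<comment> \<open>Failure for \<open>b'\<close> bounds \<open>\<bar>\<epsilon>\<bar>\<close>
          by \<open>(n - r) / (n * b')\<close>, and \<open>b' \<ge> m * (n - r)\<close> turns this
          into \<open>m * \<bar>\<epsilon>\<bar> < 1 / n\<close>.\<close>
        then have "real b' * \<bar>\<epsilon>\<bar> * n < n - real r" using assms(1,2) by (simp add: field_simps)
        moreover have "\<not> b' \<le> m * (n - r) - 1"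
        proof
          assume "b' \<le> m * (n - r) - 1"
          then have "gcd r b' > 1" using crit b(1) b' assms(2) by auto
          with cop show False by (simp add: gcd.commute coprime_iff_gcd_eq_1)
        qed
        then have "m * (n - r) \<le> b'" by simp
        then have "real (m * (n - r)) \<le> b'" by (simp only: of_nat_le_iff)
        then have "real m * (n - real r) * (\<bar>\<epsilon>\<bar> * n) \<le> b' * (\<bar>\<epsilon>\<bar> * n)"
          using assms(2) by (intro mult_right_mono) (auto simp: of_nat_diff)
        ultimately have "(n - real r) * (real m * \<bar>\<epsilon>\<bar> * n) < (n - real r) * 1"
          by (simp add: mult_ac)
        then have "real m * \<bar>\<epsilon>\<bar> * n < 1" using assms(2) by (subst (asm) mult_less_cancel_left_pos) auto
        then have "real m * \<bar>\<epsilon>\<bar> \<le> 1 / n" using assms(2) by (simp add: field_simps)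
        moreover have "real (m * r) * t - of_int (int m * a) = m * \<epsilon>"
          by (simp add: \<epsilon>_def algebra_simps)
        ultimately have "\<bar>real (m * r) * t - of_int (int m * a)\<bar> \<le> 1 / n"
          by (simp only: abs_mult abs_of_nat)
        then have "dist_int (real (m * r) * t) \<le> 1 / n" by (rule dist_int_leI)
        then show ?thesis using assms(3) by blast
      qed
    qed
  qed
qed

text \<open>The intervals \<open>\<bar>v * t - k\<bar> \<le> 1 / n\<close>, for the pairs \<open>(v, k)\<close> in the list, cover the points from \<open>a / b\<close> to \<open>1\<close>.\<close>
fun covers :: "nat \<Rightarrow> nat \<Rightarrow> nat \<Rightarrow> (nat \<times> nat) list \<Rightarrow> bool" where
  "covers n a b [] \<longleftrightarrow> b \<le> a"
| "covers n a b ((v, k) # L) \<longleftrightarrow> v > 0 \<and> k * n * b \<le> a * n * v + b \<and> covers n (k * n + 1) (n * v) L"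

text \<open>The inequality in \<open>covers\<close> says
  \<open>(k * n - 1) / (n * v) \<le> a / b\<close>: the interval of \<open>(v, k)\<close> starts no
  later than \<open>a / b\<close>. So \<open>t\<close> either lies in it or is at least its right
  end \<open>(k * n + 1) / (n * v)\<close>, from which the rest of the list continues.\<close>

lemma covers_sound:
  assumes "covers n a b L" "n > 0" "b > 0" "real a \<le> real b * t" "t < 1"
  shows "\<exists>(v, k)\<in>set L. dist_int (real v * t) \<le> 1 / n"
  using assms
proof (induction n a b L rule: covers.induct)
  case (1 n a b)
  then have "real b \<le> real a" by simp
  also have "\<dots> \<le> real b * t" using 1 by simp
  also have "\<dots> < real b * 1" using 1 by (intro mult_strict_left_mono) auto
  finally show ?case by simp
next
  case (2 n a b v k L)
  show ?case
  proof (cases "real (n * v) * t < real (k * n + 1)")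
    case True
    have "real k * n * b \<le> real a * n * v + b"
      using 2 by (simp flip: of_nat_mult of_nat_add)
    moreover have "real a * (n * v) \<le> real b * t * (n * v)"
      using 2 by (intro mult_right_mono) auto
    ultimately have "real b * (k * n) \<le> real b * (t * (n * v) + 1)" by (simp add: algebra_simps)
    then have "k * n \<le> t * (n * v) + 1" using 2 by (simp only: mult_le_cancel_left_pos of_nat_0_less_iff)
    then have "\<bar>real v * t - of_int (int k)\<bar> \<le> 1 / n"
      using True 2 by (simp add: abs_le_iff field_simps)
    then show ?thesis using dist_int_leI by fastforce
  next
    case False
    then show ?thesis using 2 by (fastforce simp: mult_ac)
  qed
qed

section \<open>Criteria for tightness\<close>

lemma LR_ge_inverse:
  assumes "finite V" "V \<noteq> {}" "n \<ge> 2" "\<And>v. v \<in> V \<Longrightarrow> \<not> n dvd v"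
  shows "1 / real n \<le> LR V"
proof (rule LR_ge[OF assms(1,2), of "1 / n"])
  \<comment> \<open>At the time \<open>1 / n\<close>, the number \<open>v / n\<close> differs from
    every integer by a nonzero multiple of \<open>1 / n\<close>.\<close>
  show "1 / real n \<in> {0..<1}" using assms(3) by simp
  fix v assume "v \<in> V"
  define k where "k = round (real v * (1 / real n))"
  have "int v - k * int n \<noteq> 0"
    using assms(4)[OF \<open>v \<in> V\<close>] by (metis dvd_triv_right eq_iff_diff_eq_0 of_nat_dvd_iff)
  then have "1 \<le> \<bar>real_of_int (int v - k * int n)\<bar>" by linarith
  also have "\<dots> = n * \<bar>real v * (1 / real n) - k\<bar>"
    using assms(3) by (simp add: abs_mult_pos' field_simps flip: abs_mult)
  finally have "1 / n \<le> \<bar>real v * (1 / real n) - k\<bar>"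
    using assms(3) by (simp add: field_simps)
  then show "1 / n \<le> dist_int (real v * (1 / real n))" by (simp add: dist_int_def k_def)
qed

lemma tightI:
  assumes "speed_set n V" "n \<ge> 2" "\<And>v. v \<in> V \<Longrightarrow> \<not> n dvd v"
    "\<And>t. \<lbrakk>0 \<le> t; t < 1\<rbrakk> \<Longrightarrow> \<exists>v\<in>V. dist_int (real v * t) \<le> 1 / n"
  shows "tight n V"
proof -
  have "finite V" "V \<noteq> {}" using assms(1,2) by (auto simp: speed_set_def)
  then show ?thesis
    unfolding tight_def using assms LR_ge_inverse LR_le by (metis order_antisym)
qed

lemma tight_baseline:
  assumes "n \<ge> 2"
  shows "tight n (baseline n)"
  using assms exists_near_baseline
  by (intro tightI) (auto simp: baseline_def speed_set_def dest: dvd_imp_le)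

lemma tight_accelerated:
  assumes "2 \<le> r" "r < n" "n \<le> m * r" "\<not> n dvd m * r"
    and "\<forall>b\<in>{n - r..m * (n - r) - 1}. gcd r b > 1"
  shows "tight n ((baseline n - {r}) \<union> {m * r})"
proof (rule tightI)
  have "m * r \<notin> baseline n - {r}" using assms(2,3) by (auto simp: baseline_def)
  moreover have "m > 0" using assms(2,3) by (cases m) auto
  ultimately show "speed_set n ((baseline n - {r}) \<union> {m * r})"
    using assms(1-3) by (auto simp: speed_set_def baseline_def)
  show "\<exists>v\<in>(baseline n - {r}) \<union> {m * r}. dist_int (real v * t) \<le> 1 / n" for t
    using exists_near_accelerated[OF assms(1,2) _ assms(5)] by (simp add: baseline_def)
qed (use assms in \<open>auto simp: baseline_def dest: dvd_imp_le\<close>)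

section \<open>Hitting sets\<close>

function progression :: "nat \<Rightarrow> nat \<Rightarrow> nat \<Rightarrow> nat list" where
  "progression N q x = (if q = 0 \<or> N < x then [] else x # progression N q (x + q))"
  by auto
termination by (relation "Wellfounded.measure (\<lambda>(N, q, x). Suc N - x)") auto

declare progression.simps [simp del]

lemma progression_complete: "q > 0 \<Longrightarrow> x + i * q \<le> N \<Longrightarrow> x + i * q \<in> set (progression N q x)"
proof (induction i arbitrary: x)
  case 0
  then show ?case by (subst progression.simps) simp
next
  case (Suc i)
  then have "x + q + i * q \<in> set (progression N q (x + q))" by (intro Suc.IH) simp_all
  then show ?case using Suc.prems by (subst progression.simps) (simp add: add.assoc)
qed

text \<open>The start \<open>x = q\<close> encodes the residue 0 restricted to positive members,
  since 0 is not a speed.\<close>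

lemma in_progression:
  assumes "[v = x] (mod q)" "q > 0" "x < q \<or> x = q \<and> v > 0" "v \<le> N"
  shows "v \<in> set (progression N q x)"
proof -
  have "x \<le> v"
  proof (cases "x < q")
    case True
    with assms(1) have "x = v mod q" by (simp add: cong_def)
    then show ?thesis by simp
  next
    case False
    with assms(1,3) have "q dvd v" "0 < v" "x = q" by (auto simp: cong_def dvd_eq_mod_eq_0)
    then show ?thesis by (simp add: dvd_imp_le)
  qed
  moreover from this have "q dvd v - x" using assms(1) cong_altdef_nat by blast
  then obtain i where "v - x = i * q" by (metis dvdE mult.commute)
  ultimately have "v = x + i * q" by simp
  then show ?thesis using progression_complete[OF assms(2), of x i N] assms(4) by simp
qed

text \<open>\<open>y\<close> is the multiple of \<open>c\<close> reached so far, reduced modulo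
  \<open>q\<close>; each round adds \<open>c\<close> and covers the new residue together with its
  negative.\<close>

primrec symmetric_progressions :: "nat \<Rightarrow> nat \<Rightarrow> nat \<Rightarrow> nat \<Rightarrow> nat \<Rightarrow> nat list" where
  "symmetric_progressions N q c y 0 = []"
| "symmetric_progressions N q c y (Suc m) = (let z = (y + c) mod q in
     progression N q z @ progression N q (q - z) @ symmetric_progressions N q c z m)"

definition blockers :: "nat \<Rightarrow> nat \<Rightarrow> nat \<Rightarrow> nat \<Rightarrow> nat list" where
  "blockers n N q c = progression N q q @ symmetric_progressions N q c 0 (q div n)"

lemma in_symmetric_progressions:
  assumes "[v = y + j * c] (mod q) \<or> [v + (y + j * c) = 0] (mod q)"
    and "0 < j" "j \<le> m" "q > 0" "0 < v" "v \<le> N"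
  shows "v \<in> set (symmetric_progressions N q c y m)"
  using assms(1-3)
proof (induction m arbitrary: y j)
  case (Suc m)
  define z where "z = (y + c) mod q"
  have "z < q" using assms(4) by (simp add: z_def)
  have shift: "[y + j * c = z + (j - 1) * c] (mod q)"
    using Suc.prems(2) by (cases j) (simp_all add: z_def cong_def mod_simps add_ac)
  have eqs: "[v = z + (j - 1) * c] (mod q) \<or> [v + (z + (j - 1) * c) = 0] (mod q)"
    using Suc.prems(1) shift by (metis cong_add_lcancel_nat cong_sym cong_trans)
  show ?case
  proof (cases "j = 1")
    case True
    have "[v = q - z] (mod q)" if "[v + z = 0] (mod q)"
    proof -
      have "[v + z = (q - z) + z] (mod q)" using that \<open>z < q\<close> by (simp add: cong_def)
      then show ?thesis by (simp only: cong_add_rcancel_nat)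
    qed
    then have "v \<in> set (progression N q z) \<or> v \<in> set (progression N q (q - z))"
      using eqs True \<open>z < q\<close> assms(4-6) by (auto intro!: in_progression)
    then show ?thesis by (auto simp: z_def Let_def)
  next
    case False
    then show ?thesis using Suc.IH[OF eqs] Suc.prems by (auto simp: z_def Let_def)
  qed
qed simp

lemma blockers_complete:
  assumes "blocks n q c v" "q > 0" "0 < v" "v \<le> N"
  shows "v \<in> set (blockers n N q c)"
proof -
  obtain j where j: "j \<le> q div n" "[v = 0 + j * c] (mod q) \<or> [v + (0 + j * c) = 0] (mod q)"
    using assms(1) by (auto simp: blocks_def)
  show ?thesis
  proof (cases "j = 0")
    case True
    then have "[v = q] (mod q)" using j(2) by (auto simp: cong_def)
    then show ?thesis using assms by (auto simp: blockers_def intro!: in_progression)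
  next
    case False
    then show ?thesis using in_symmetric_progressions[OF j(2)] j(1) assms by (auto simp: blockers_def)
  qed
qed

section \<open>Search for small hitting sets\<close>

primrec meets :: "'a list \<Rightarrow> 'a list \<Rightarrow> bool" where
  "meets S [] \<longleftrightarrow> False"
| "meets S (x # xs) \<longleftrightarrow> x \<in> set S \<or> meets S xs"

lemma meets_iff: "meets S B \<longleftrightarrow> set B \<inter> set S \<noteq> {}"
  by (induction B) auto

primrec branch :: "('a list \<Rightarrow> 'b list) \<Rightarrow> 'a list \<Rightarrow> 'a list \<Rightarrow> 'b list" where
  "branch f S [] = []"
| "branch f S (x # xs) = f (x # S) @ branch f S xs"

lemma set_branch: "set (branch f S xs) = (\<Union>x\<in>set xs. set (f (x # S)))"
  by (induction xs) auto

primrec extensions :: "'a list list \<Rightarrow> nat \<Rightarrow> 'a list \<Rightarrow> 'a list list" where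
  "extensions [] k S = [S]"
| "extensions (B # Bs) k S =
     (if meets S B then extensions Bs k S
      else case k of 0 \<Rightarrow> [] | Suc k' \<Rightarrow> branch (extensions Bs k') S B)"

text \<open>The budget \<open>k\<close> bounds the part of \<open>V\<close> outside
  \<open>S\<close>. A list that \<open>S\<close> misses has an element in that part, and adding it
  shrinks the part. Only an inclusion results, since a proper subset of \<open>V\<close> may already
  hit all lists.\<close>

lemma extensions_complete:
  assumes "finite V" "\<And>B. B \<in> set Bs \<Longrightarrow> set B \<inter> V \<noteq> {}" "set S \<subseteq> V" "card (V - set S) \<le> k"
  shows "\<exists>S'\<in>set (extensions Bs k S). set S' \<subseteq> V"
  using assms
proof (induction Bs arbitrary: k S)
  case (Cons B Bs)
  show ?case
  proof (cases "meets S B")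
    case True
    then show ?thesis using Cons by simp
  next
    case False
    obtain x where x: "x \<in> set B" "x \<in> V" using Cons.prems(2)[of B] by auto
    with False have "x \<in> V - set S" by (auto simp: meets_iff)
    then have "card (V - set (x # S)) < card (V - set S)"
      using Cons.prems(1) by (intro psubset_card_mono) auto
    then obtain k' where k': "k = Suc k'" "card (V - set (x # S)) \<le> k'"
      using Cons.prems(4) by (cases k) auto
    then obtain S' where "S' \<in> set (extensions Bs k' (x # S))" "set S' \<subseteq> V"
      using Cons.IH[of "x # S" k'] Cons.prems x by auto
    then show ?thesis using False k' x by (auto simp: set_branch)
  qed
qed auto

text \<open>Bounding the search by packings of sets with at most two elements is weaker, but cheaper to evaluate.\<close>
fun beyond_pair :: "'a list \<Rightarrow> bool" where
  "beyond_pair (x # y # z # xs) \<longleftrightarrow> True"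
| "beyond_pair _ \<longleftrightarrow> False"

primrec packing :: "'a list \<Rightarrow> 'a list list \<Rightarrow> nat" where
  "packing U [] = 0"
| "packing U (B # Bs) = (if beyond_pair B \<or> meets U B then packing U Bs else Suc (packing (B @ U) Bs))"

text \<open>The counted lists are disjoint from \<open>U\<close> and from one another, so each needs
  an element of \<open>V\<close> of its own.\<close>

lemma packing_le:
  assumes "finite V" "\<And>B. B \<in> set Bs \<Longrightarrow> set B \<inter> V \<noteq> {}"
  shows "packing U Bs \<le> card (V - set U)"
  using assms(2)
proof (induction Bs arbitrary: U)
  case (Cons B Bs)
  show ?case
  proof (cases "beyond_pair B \<or> meets U B")
    case True
    then show ?thesis using Cons by auto
  next
    case False
    obtain x where x: "x \<in> set B" "x \<in> V" using Cons.prems[of B] by auto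
    with False have "x \<in> V - set U" by (auto simp: meets_iff)
    with x have "card (V - set (B @ U)) < card (V - set U)"
      using assms(1) by (intro psubset_card_mono) auto
    then show ?thesis using False Cons.IH[of "B @ U"] Cons.prems by force
  qed
qed simp

primrec shorter :: "'a list \<Rightarrow> 'b list \<Rightarrow> bool" where
  "shorter xs [] \<longleftrightarrow> False"
| "shorter xs (y # ys) \<longleftrightarrow> (case xs of [] \<Rightarrow> True | x # xs' \<Rightarrow> shorter xs' ys)"

primrec shortest :: "'a list \<Rightarrow> 'a list list \<Rightarrow> 'a list" where
  "shortest B [] = B"
| "shortest B (C # Cs) = (if shorter C B then shortest C Cs else shortest B Cs)"

lemma shortest_in: "shortest B Cs \<in> set (B # Cs)"
proof (induction Cs arbitrary: B)
  case (Cons C Cs)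
  show ?case using Cons[of B] Cons[of C] by auto
qed simp

primrec unhit :: "'a \<Rightarrow> 'a list list \<Rightarrow> 'a list list" where
  "unhit x [] = []"
| "unhit x (B # Bs) = (if x \<in> set B then unhit x Bs else B # unhit x Bs)"

lemma set_unhit: "set (unhit x Bs) = {B \<in> set Bs. x \<notin> set B}"
  by (induction Bs) auto

text \<open>\<open>f\<close> is the search with one element less. After the branch for
  \<open>x\<close>, the remaining branches assume that \<open>x\<close> is not chosen and drop it
  everywhere, so that no set is found in several orders. The last candidate has no such alternative,
  because some candidate must be chosen.\<close>

primrec branch_excluding :: "('a list list \<Rightarrow> 'a list list) \<Rightarrow> 'a list list \<Rightarrow> 'a list \<Rightarrow> 'a list list" where
  "branch_excluding f Bs [] = []"
| "branch_excluding f Bs (x # xs) =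
     map ((#) x) (f (unhit x Bs)) @
       (if xs = [] then [] else branch_excluding f (map (removeAll x) Bs) xs)"

text \<open>The packing number is a lower bound for the size of a hitting set and prunes the tree;
  branching on a shortest list keeps it narrow.\<close>

fun hitting_sets :: "nat \<Rightarrow> 'a list list \<Rightarrow> 'a list list" where
  "hitting_sets k [] = [[]]"
| "hitting_sets 0 (B # Bs) = []"
| "hitting_sets (Suc k) (B # Bs) =
     (if Suc k < packing [] (B # Bs) then []
      else branch_excluding (hitting_sets k) (B # Bs) (shortest B Bs))"

lemma branch_excluding_complete:
  assumes IH: "\<And>V Bs. \<lbrakk>finite V; \<And>B. B \<in> set Bs \<Longrightarrow> set B \<inter> V \<noteq> {}; card V \<le> k\<rbrakk>
      \<Longrightarrow> \<exists>S\<in>set (f Bs). set S \<subseteq> V"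
    and "finite V" "\<And>B. B \<in> set Bs \<Longrightarrow> set B \<inter> V \<noteq> {}" "card V \<le> Suc k" "set xs \<inter> V \<noteq> {}"
  shows "\<exists>S\<in>set (branch_excluding f Bs xs). set S \<subseteq> V"
  using assms(3,5)
proof (induction xs arbitrary: Bs)
  case (Cons x xs)
  show ?case
  proof (cases "x \<in> V")
    case True
    then have "card (V - {x}) \<le> k" using assms(2,4) by simp
    moreover have "set B \<inter> (V - {x}) \<noteq> {}" if "B \<in> set (unhit x Bs)" for B
      using that Cons.prems(1)[of B] by (auto simp: set_unhit)
    ultimately obtain S where "S \<in> set (f (unhit x Bs))" "set S \<subseteq> V - {x}"
      using IH[of "V - {x}" "unhit x Bs"] assms(2) by auto
    then show ?thesis using True by (intro bexI[of _ "x # S"]) auto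
  next
    case False
    then have "set B \<inter> V \<noteq> {}" if "B \<in> set (map (removeAll x) Bs)" for B
      using that Cons.prems(1) by fastforce
    moreover have "xs \<noteq> []" using Cons.prems(2) False by auto
    ultimately show ?thesis using Cons.IH[of "map (removeAll x) Bs"] Cons.prems(2) False by auto
  qed
qed simp

lemma hitting_sets_complete:
  assumes "finite V" "\<And>B. B \<in> set Bs \<Longrightarrow> set B \<inter> V \<noteq> {}" "card V \<le> k"
  shows "\<exists>S\<in>set (hitting_sets k Bs). set S \<subseteq> V"
  using assms
proof (induction k arbitrary: V Bs)
  case 0
  then have "Bs = []" by (cases Bs) auto
  then show ?case by simp
next
  case (Suc k)
  show ?case
  proof (cases Bs)
    case (Cons B Cs)
    have "packing [] Bs \<le> card V" using packing_le[OF Suc.prems(1,2), of Bs "[]"] by simp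
    moreover have "\<exists>S\<in>set (branch_excluding (hitting_sets k) Bs (shortest B Cs)). set S \<subseteq> V"
      using Suc.prems Suc.IH shortest_in[of B Cs] Cons by (intro branch_excluding_complete) auto
    ultimately show ?thesis using Suc.prems(3) Cons by auto
  qed simp
qed

section \<open>Replacing one or two baseline speeds\<close>

primrec first_coprime :: "(nat \<times> nat) list \<Rightarrow> nat \<Rightarrow> (nat \<times> nat) list" where
  "first_coprime [] k = []"
| "first_coprime (x # xs) k =
     (if k = 0 then []
      else if gcd (fst x) (snd x) = 1 then x # first_coprime xs (k - 1) else first_coprime xs k)"

text \<open>The reversal lets \<open>first_coprime\<close> prefer the largest moduli.\<close>

definition paired :: "nat \<Rightarrow> nat list \<Rightarrow> (nat \<times> nat) list" where
  "paired r qs = map (\<lambda>q. (q, r)) (rev qs)"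

text \<open>
  Pairs \<open>(q, c)\<close> whose only blocker among the baseline speeds is \<open>r\<close>. The first kind is \<open>t = a / r\<close>;
  the others come from residues \<open>\<plusminus>j * r\<close> modulo \<open>q\<close>, and from \<open>2 * c = - r\<close> modulo \<open>q = 2 * c + r\<close>.
  The cut-off at four pairs of each kind is empirical.
\<close>
definition replacement_tests :: "nat \<Rightarrow> nat \<Rightarrow> (nat \<times> nat) list" where
  "replacement_tests n r =
     (if n \<le> 2 * r then [(r, 1)] else []) @
     first_coprime (paired r [n + r..<2 * n]) 4 @
     (if n \<le> 2 * r then first_coprime (paired r [n + 2 * r..<3 * n]) 4 else []) @
     first_coprime (map (\<lambda>i. (2 * i + r, i)) (rev [n..<(3 * n - r + 1) div 2])) 4 @
     (if n \<le> 2 * r then first_coprime (paired r [n + 3 * r..<4 * n]) 4 else [])"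

lemma set_first_coprime: "set (first_coprime xs k) \<subseteq> {x \<in> set xs. coprime (snd x) (fst x)}"
proof (induction xs arbitrary: k)
  case (Cons x xs)
  show ?case
    using Cons[of k] Cons[of "k - 1"] by (auto simp: coprime_iff_gcd_eq_1 gcd.commute)
qed simp

lemma replacement_tests_valid:
  assumes "x \<in> set (replacement_tests n r)" "0 < n" "0 < r"
  shows "coprime (snd x) (fst x)" "0 < fst x"
  using assms by (auto simp: replacement_tests_def paired_def split: if_splits dest!: subsetD[OF set_first_coprime])

text \<open>\<open>None\<close> rejects a test with a blocker below \<open>n\<close> other than
  \<open>r\<close>: such a speed may have been kept, and then the test forces no new speed.\<close>

primrec replacements :: "nat \<Rightarrow> nat \<Rightarrow> nat list \<Rightarrow> nat list option" where
  "replacements n r [] = Some []"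
| "replacements n r (v # B) =
     (if n \<le> v then map_option ((#) v) (replacements n r B)
      else if v = r then replacements n r B else None)"

lemma set_replacements: "replacements n r B = Some C \<Longrightarrow> set B \<subseteq> insert r (set C)"
  by (induction B arbitrary: C) (auto split: if_splits)

primrec replacement_blockers :: "nat \<Rightarrow> nat \<Rightarrow> nat \<Rightarrow> (nat \<times> nat) list \<Rightarrow> nat list list" where
  "replacement_blockers n N r [] = []"
| "replacement_blockers n N r (x # xs) =
    (case replacements n r (blockers n N (fst x) (snd x)) of
       None \<Rightarrow> replacement_blockers n N r xs
     | Some B \<Rightarrow> B # replacement_blockers n N r xs)"

lemma replacement_blockers_hit:
  assumes "B \<in> set (replacement_blockers n N r xs)"
    and "\<And>x. x \<in> set xs \<Longrightarrow> coprime (snd x) (fst x)" "\<And>x. x \<in> set xs \<Longrightarrow> 0 < fst x"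
    and "n > 0" "finite V" "V \<noteq> {}" "0 \<notin> V" "LR V \<le> 1 / n" "r \<notin> V" "\<forall>v\<in>V. v \<le> N"
  shows "set B \<inter> V \<noteq> {}"
  using assms(1-3)
proof (induction xs)
  case (Cons x xs)
  show ?case
  proof (cases "replacements n r (blockers n N (fst x) (snd x)) = Some B")
    case True
    obtain v where v: "v \<in> V" "blocks n (fst x) (snd x) v"
      using exists_block[of V n "fst x" "snd x"] Cons.prems assms(4-) by auto
    then have "v \<in> set (blockers n N (fst x) (snd x))"
      using Cons.prems(3) assms(4-) by (intro blockers_complete) (auto intro: gr0I)
    then show ?thesis using set_replacements[OF True] v(1) assms(9) by auto
  next
    case False
    then show ?thesis using Cons by (auto split: option.splits)
  qed
qed simp

lemma replacements_ge: "replacements n r B = Some C \<Longrightarrow> v \<in> set C \<Longrightarrow> n \<le> v"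
  by (induction B arbitrary: C) (auto split: if_splits)

lemma replacement_blockers_ge: "B \<in> set (replacement_blockers n N r xs) \<Longrightarrow> v \<in> set B \<Longrightarrow> n \<le> v"
  by (induction xs) (auto split: option.splits dest: replacements_ge)

definition row :: "nat \<Rightarrow> nat \<Rightarrow> nat \<Rightarrow> nat list list" where
  "row n N r = replacement_blockers n N r (replacement_tests n r)"

text \<open>The lists of a row contain only numbers from \<open>n\<close> on, so the speed that hits
  them is a new one.\<close>

lemma row_hit:
  assumes "B \<in> set (row n N r)" "0 < n" "0 < r" "finite V" "V \<noteq> {}" "0 \<notin> V" "LR V \<le> 1 / n"
    "r \<notin> V" "\<forall>v\<in>V. v \<le> N"
  shows "set B \<inter> {v \<in> V. n \<le> v} \<noteq> {}"
  using replacement_blockers_hit[of B n N r "replacement_tests n r" V] replacement_tests_valid[of _ n r]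
    replacement_blockers_ge assms unfolding row_def by blast

definition single_survivors :: "nat \<Rightarrow> nat \<Rightarrow> (nat \<times> nat \<times> nat list) list" where
  "single_survivors n r = map (\<lambda>S. (n, r, S)) (extensions (row n (10 * n) r) 1 [])"

definition all_single_survivors :: "nat \<Rightarrow> (nat \<times> nat \<times> nat list) list" where
  "all_single_survivors n = concat (map (single_survivors n) [1..<n])"

lemma all_single_survivors_complete:
  assumes "2 \<le> n" "r \<in> baseline n" "n \<le> w" "w \<le> 10 * n" "LR ((baseline n - {r}) \<union> {w}) \<le> 1 / n"
  obtains S where "(n, r, S) \<in> set (all_single_survivors n)" "set S \<subseteq> {w}"
proof -
  let ?V = "(baseline n - {r}) \<union> {w}"
  have new: "{v \<in> ?V. n \<le> v} = {w}" using assms(3) by (auto simp: baseline_def)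
  have "set B \<inter> {v \<in> ?V. n \<le> v} \<noteq> {}" if "B \<in> set (row n (10 * n) r)" for B
    using that assms by (intro row_hit[of B n "10 * n" r]) (auto simp: baseline_def)
  then obtain S where "S \<in> set (extensions (row n (10 * n) r) 1 [])" "set S \<subseteq> {w}"
    using extensions_complete[of "{w}" "row n (10 * n) r" "[]" 1] unfolding new by auto
  moreover have "r \<in> {1..<n}" using assms(2) by (auto simp: baseline_def)
  ultimately show ?thesis
    by (intro that[of S]) (auto simp: all_single_survivors_def single_survivors_def)
qed

definition keyed_row :: "nat \<Rightarrow> nat \<Rightarrow> nat \<times> nat list list" where
  "keyed_row n r = (r, row n (4 * n) r)"

definition pair_survivors ::
    "nat \<Rightarrow> nat \<times> nat list list \<Rightarrow> nat \<times> nat list list \<Rightarrow> (nat \<times> nat \<times> nat \<times> nat list) list" where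
  "pair_survivors n x y = map (\<lambda>S. (n, fst x, fst y, S)) (extensions (snd y @ snd x) 2 [])"

primrec row_pairs :: "nat \<Rightarrow> (nat \<times> nat list list) list \<Rightarrow> (nat \<times> nat \<times> nat \<times> nat list) list" where
  "row_pairs n [] = []"
| "row_pairs n (x # xs) = concat (map (pair_survivors n x) xs) @ row_pairs n xs"

lemma set_row_pairs:
  "i < j \<Longrightarrow> j < length xs \<Longrightarrow> set (pair_survivors n (xs ! i) (xs ! j)) \<subseteq> set (row_pairs n xs)"
proof (induction xs arbitrary: i j)
  case (Cons x xs)
  then obtain j' where "j = Suc j'" "j' < length xs" by (cases j) auto
  with Cons show ?case by (cases i) fastforce+
qed simp

definition all_pair_survivors :: "nat \<Rightarrow> (nat \<times> nat \<times> nat \<times> nat list) list" where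
  "all_pair_survivors n = row_pairs n (map (keyed_row n) [1..<n])"

text \<open>A row presupposes only that its own \<open>r\<close> is absent, so it stays valid when a
  second speed is removed. The two new speeds therefore hit both rows.\<close>

lemma all_pair_survivors_complete:
  assumes "4 \<le> n" "r1 \<in> baseline n" "r2 \<in> baseline n" "r1 < r2"
    and "n \<le> w1" "w1 \<le> 4 * n" "n \<le> w2" "w2 \<le> 4 * n"
    and "LR ((baseline n - {r1, r2}) \<union> {w1, w2}) \<le> 1 / n"
  obtains S where "(n, r1, r2, S) \<in> set (all_pair_survivors n)" "set S \<subseteq> {w1, w2}"
proof -
  let ?V = "(baseline n - {r1, r2}) \<union> {w1, w2}"
  have new: "{v \<in> ?V. n \<le> v} = {w1, w2}" using assms by (auto simp: baseline_def)
  have "set B \<inter> {v \<in> ?V. n \<le> v} \<noteq> {}" if "B \<in> set (row n (4 * n) r)" "r \<in> {r1, r2}" for B r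
    using that assms by (intro row_hit[of B n "4 * n" r]) (auto simp: baseline_def)
  then have hit: "set B \<inter> {w1, w2} \<noteq> {}" if "B \<in> set (row n (4 * n) r2 @ row n (4 * n) r1)" for B
    using that unfolding new by auto
  have "\<exists>S\<in>set (extensions (row n (4 * n) r2 @ row n (4 * n) r1) 2 []). set S \<subseteq> {w1, w2}"
    by (rule extensions_complete[OF _ hit]) (simp_all add: card_insert_if)
  then obtain S where "S \<in> set (extensions (row n (4 * n) r2 @ row n (4 * n) r1) 2 [])" "set S \<subseteq> {w1, w2}"
    by blast
  then have S: "(n, r1, r2, S) \<in> set (pair_survivors n (keyed_row n r1) (keyed_row n r2))"
    by (auto simp: pair_survivors_def keyed_row_def)
  have "set (pair_survivors n (keyed_row n r1) (keyed_row n r2)) \<subseteq> set (all_pair_survivors n)"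
    using set_row_pairs[of "r1 - 1" "r2 - 1" "map (keyed_row n) [1..<n]" n] assms(2-4)
    by (simp add: all_pair_survivors_def baseline_def)
  with S \<open>set S \<subseteq> {w1, w2}\<close> show ?thesis by (intro that) auto
qed

section \<open>Sets with all speeds below \<open>2 * n\<close>\<close>

text \<open>Only the length of \<open>[n, n, n, n]\<close> matters: lists of at most three entries
  are kept.\<close>

definition short_blockers :: "nat \<Rightarrow> nat list list \<Rightarrow> nat list list" where
  "short_blockers n = filter (\<lambda>B. shorter B [n, n, n, n])"

definition coprime_blockers :: "nat \<Rightarrow> nat \<Rightarrow> nat \<Rightarrow> nat list list" where
  "coprime_blockers n q c = (if gcd c q = 1 then [blockers n (2 * n - 1) q c] else [])"

text \<open>\<open>c\<close> and \<open>q - c\<close> have the same blockers, so \<open>c\<close> up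
  to \<open>q div 2\<close> suffices. For \<open>q < n\<close> only multiples of \<open>q\<close>
  block, whatever \<open>c\<close> is, and \<open>c = 1\<close> represents all cases.\<close>

definition modulus_blockers :: "nat \<Rightarrow> nat \<Rightarrow> nat list list" where
  "modulus_blockers n q = concat (map (coprime_blockers n q) [1..<Suc (if q < n then 1 else q div 2)])"

text \<open>The modulus bound is empirical: \<open>3 * n\<close> is too small for some \<open>n \<le> 9\<close>.\<close>
definition general_blockers :: "nat \<Rightarrow> nat list list" where
  "general_blockers n =
     remdups (map sort (short_blockers n (concat (map (modulus_blockers n) [2..<max (3 * n) 36]))))"

text \<open>Doubling all speeds of the baseline does not change \<open>LR\<close>, so no test can
  exclude that set; it is dropped because its gcd is 2.\<close>

definition general_survivors :: "nat \<Rightarrow> nat list list" where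
  "general_survivors n =
     filter (\<lambda>S. S \<noteq> map ((*) 2) [1..<n]) (map sort (hitting_sets (n - 1) (general_blockers n)))"

lemma general_blockers_hit:
  assumes "B \<in> set (general_blockers n)" "0 < n" "finite V" "V \<noteq> {}" "0 \<notin> V" "LR V \<le> 1 / n"
    "\<forall>v\<in>V. v < 2 * n"
  shows "set B \<inter> V \<noteq> {}"
proof -
  obtain q c where q: "2 \<le> q" "coprime c q" "B = sort (blockers n (2 * n - 1) q c)"
  proof -
    obtain q B' where q: "2 \<le> q" "B' \<in> set (modulus_blockers n q)" "B = sort B'"
      using assms(1) by (auto simp: general_blockers_def short_blockers_def)
    then obtain c where "B' \<in> set (coprime_blockers n q c)"
      by (auto simp: modulus_blockers_def simp del: upt_Suc)
    with q show ?thesis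
      by (intro that) (auto simp: coprime_blockers_def coprime_iff_gcd_eq_1 split: if_splits)
  qed
  then obtain v where "v \<in> V" "blocks n q c v" using exists_block[of V n q c] assms by auto
  then have "v \<in> set B" unfolding q(3) set_sort
    using assms q(1) by (intro blockers_complete) (auto intro: gr0I)
  with \<open>v \<in> V\<close> show ?thesis by auto
qed

lemma general_survivors_complete:
  assumes "speed_set n V" "2 \<le> n" "Gcd V = 1" "\<forall>v\<in>V. v < 2 * n" "LR V \<le> 1 / n"
  obtains S where "S \<in> set (general_survivors n)" "set S \<subseteq> V"
proof -
  have V: "finite V" "0 \<notin> V" "card V = n - 1" using assms(1,2) by (auto simp: speed_set_def)
  then have "V \<noteq> {}" using assms(2) by auto
  then obtain S where S: "S \<in> set (hitting_sets (n - 1) (general_blockers n))" "set S \<subseteq> V"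
    using hitting_sets_complete[of V "general_blockers n" "n - 1"] general_blockers_hit[of _ n V] V assms
    by auto
  \<comment> \<open>If \<open>S\<close> were the doubled baseline, it would exhaust \<open>V\<close>
    by cardinality, and 2 would divide \<open>Gcd V\<close>.\<close>
  have "sort S \<noteq> map ((*) 2) [1..<n]"
  proof
    assume "sort S = map ((*) 2) [1..<n]"
    then have "set S = (*) 2 ` {1..<n}" by (metis set_sort set_map set_upt)
    moreover from this have "card (set S) = n - 1" by (simp add: card_image inj_on_def)
    ultimately have "V = (*) 2 ` {1..<n}" using S(2) V by (metis card_subset_eq)
    then have "2 dvd Gcd V" by (auto intro: Gcd_greatest)
    with assms(3) show False by simp
  qed
  with S show ?thesis by (intro that[of "sort S"]) (auto simp: general_survivors_def)
qed

lemma not_blocked_imp_LR_gt: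
  assumes "finite V" "V \<noteq> {}" "0 \<notin> V" "n > 0" "q > 0" "coprime c q" "\<forall>v\<in>V. v \<le> N"
    and "set (blockers n N q c) \<inter> V = {}"
  shows "1 / n < LR V"
proof (rule ccontr)
  assume "\<not> ?thesis"
  then obtain v where "v \<in> V" "blocks n q c v" using exists_block[of V n q c] assms by auto
  then show False using blockers_complete[of n q c v N] assms by (force intro: gr0I)
qed

section \<open>Results of the searches\<close>

lemma single_survivors_5_21: "concat (map all_single_survivors [5..<22]) =
    [(5, 2, [7]), (6, 2, [9]), (8, 6, [12]), (14, 12, [24]), (20, 18, [36])]"
  by code_simp

lemma single_survivors_22_29: "concat (map all_single_survivors [22..<30]) =
    [(26, 24, [48])]"
  by code_simp

lemma single_survivors_30_35: "concat (map all_single_survivors [30..<36]) =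
    [(32, 30, [60]), (32, 30, [90]), (33, 30, [60])]"
  by code_simp

lemma single_survivors_36_40: "concat (map all_single_survivors [36..<41]) =
    [(38, 36, [72])]"
  by code_simp

lemma single_survivors_41_45: "concat (map all_single_survivors [41..<46]) =
    [(44, 42, [84])]"
  by code_simp

text \<open>The survivors for \<open>n = 7\<close> and \<open>n = 11\<close> pass all tests of their
  rows without being tight; \<open>pair_tight_imp\<close> excludes them by further pairs
  \<open>(q, c)\<close>.\<close>

lemma pair_survivors_6_17: "concat (map all_pair_survivors [6..<18]) = [(7, 2, 6, [13, 18]), (8, 2, 3, [13, 11]), (11, 4, 10, [42, 30])]"
  by code_simp

lemma pair_survivors_18_22: "concat (map all_pair_survivors [18..<23]) = []"
  by code_simp

lemma pair_survivors_23_26: "concat (map all_pair_survivors [23..<27]) = []"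
  by code_simp

lemma pair_survivors_27_29: "concat (map all_pair_survivors [27..<30]) = []"
  by code_simp

lemma pair_survivors_30_32: "concat (map all_pair_survivors [30..<33]) = []"
  by code_simp

lemma pair_survivors_33_34: "concat (map all_pair_survivors [33..<35]) = []"
  by code_simp

lemma general_survivors_4_12:
  "map general_survivors [4..<13] =
    [[[1..<4]],
     [[1..<5], [1, 3, 4, 7]],
     [[1..<6], [1, 3, 4, 5, 9]],
     [[1..<7]],
     [[1..<8], [1, 4, 5, 6, 7, 11, 13], [1, 2, 3, 4, 5, 7, 12]],
     [[1..<9]],
     [[1..<10]],
     [[1..<11]],
     [[1..<12]]]"
  by code_simp

lemma general_survivors_13: "general_survivors 13 = [[1..<13]]"
  by code_simp

lemma general_survivors_14: "general_survivors 14 = [[1..<14], [1..<12] @ [13, 24]]"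
  by code_simp

lemma general_survivors_15: "general_survivors 15 = [[1..<15]]"
  by code_simp

lemma general_survivors_16: "general_survivors 16 = [[1..<16]]"
  by code_simp

section \<open>From survivors to the classification\<close>

definition tight_replacements :: "(nat \<times> nat \<times> nat) set" where
  "tight_replacements =
    {(5, 2, 7), (6, 2, 9), (8, 6, 12), (14, 12, 24), (20, 18, 36), (26, 24, 48),
     (32, 30, 60), (32, 30, 90), (33, 30, 60), (38, 36, 72), (44, 42, 84)}"

lemma all_single_survivors_cases:
  assumes "5 \<le> n" "n \<le> 45" "(n, r, S) \<in> set (all_single_survivors n)"
  shows "(n, r, S) \<in> (\<lambda>(n, r, w). (n, r, [w])) ` tight_replacements"
proof -
  have "n \<in> set ([5..<22] @ [22..<30] @ [30..<36] @ [36..<41] @ [41..<46])"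
    using assms(1,2) unfolding set_append set_upt by auto
  then have "(n, r, S) \<in> set (concat (map all_single_survivors
      ([5..<22] @ [22..<30] @ [30..<36] @ [36..<41] @ [41..<46])))"
    using assms(3) unfolding set_concat set_map by blast
  then show ?thesis
    unfolding map_append concat_append single_survivors_5_21 single_survivors_22_29
      single_survivors_30_35 single_survivors_36_40 single_survivors_41_45
    by (simp add: tight_replacements_def)
qed

lemma all_pair_survivors_cases:
  assumes "6 \<le> n" "n \<le> 34" "(n, r1, r2, S) \<in> set (all_pair_survivors n)"
  shows "(n, r1, r2, S) \<in> {(7, 2, 6, [13, 18]), (8, 2, 3, [13, 11]), (11, 4, 10, [42, 30])}"
proof -
  have "n \<in> set ([6..<18] @ [18..<23] @ [23..<27] @ [27..<30] @ [30..<33] @ [33..<35])"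
    using assms(1,2) unfolding set_append set_upt by auto
  then have "(n, r1, r2, S) \<in> set (concat (map all_pair_survivors
      ([6..<18] @ [18..<23] @ [23..<27] @ [27..<30] @ [30..<33] @ [33..<35])))"
    using assms(3) unfolding set_concat set_map by blast
  then show ?thesis
    unfolding map_append concat_append pair_survivors_6_17 pair_survivors_18_22 pair_survivors_23_26
      pair_survivors_27_29 pair_survivors_30_32 pair_survivors_33_34 by auto
qed

definition exceptional :: "nat \<Rightarrow> nat set set" where
  "exceptional n =
     (if n = 5 then {{1, 3, 4, 7}}
      else if n = 6 then {{1, 3, 4, 5, 9}}
      else if n = 8 then {{1, 2, 3, 4, 5, 7, 12}, {1, 4, 5, 6, 7, 11, 13}}
      else if n = 14 then {{1..11} \<union> {13, 24}}
      else {})"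

lemma general_survivors_cases:
  assumes "4 \<le> n" "n \<le> 16" "S \<in> set (general_survivors n)"
  shows "distinct S" "length S = n - 1" "set S \<in> {baseline n} \<union> exceptional n"
proof -
  \<comment> \<open>The range is written out so that the list equation splits into one equation for
    each \<open>n\<close>.\<close>
  have "[4..<13] = [4, 5, 6, 7, 8, 9, 10, 11, 12]" by (simp add: upt_rec)
  note small = general_survivors_4_12[unfolded this list.map list.inject]
  have "S = [1..<n] \<or> n = 5 \<and> S = [1, 3, 4, 7] \<or> n = 6 \<and> S = [1, 3, 4, 5, 9] \<or>
      n = 8 \<and> (S = [1, 4, 5, 6, 7, 11, 13] \<or> S = [1, 2, 3, 4, 5, 7, 12]) \<or>
      n = 14 \<and> S = [1..<12] @ [13, 24]"
  proof -
    have "n = 4 \<or> n = 5 \<or> n = 6 \<or> n = 7 \<or> n = 8 \<or> n = 9 \<or> n = 10 \<or> n = 11 \<or> n = 12 \<or> n = 13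
      \<or> n = 14 \<or> n = 15 \<or> n = 16"
      using assms(1,2) by arith
    then show ?thesis
      using assms(3) small general_survivors_13 general_survivors_14 general_survivors_15
        general_survivors_16 by (elim disjE) (simp_all, auto?)
  qed
  then consider "S = [1..<n]" | "n = 5" "S = [1, 3, 4, 7]" | "n = 6" "S = [1, 3, 4, 5, 9]"
    | "n = 8" "S = [1, 4, 5, 6, 7, 11, 13]" | "n = 8" "S = [1, 2, 3, 4, 5, 7, 12]"
    | "n = 14" "S = [1..<12] @ [13, 24]"
    by blast
  then have "distinct S \<and> length S = n - 1 \<and> set S \<in> {baseline n} \<union> exceptional n"
  proof cases
    case 1
    then show ?thesis by (auto simp: baseline_def)
  next
    case 6
    have "set S = {1..11} \<union> {13, 24}" unfolding 6(2) set_append set_upt by auto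
    then have "set S \<in> exceptional n" using 6(1) by (simp add: exceptional_def)
    then show ?thesis using 6 by simp
  qed (simp_all add: exceptional_def)
  then show "distinct S" "length S = n - 1" "set S \<in> {baseline n} \<union> exceptional n" by blast+
qed

text \<open>Every survivor has \<open>n - 1\<close> distinct entries, so its inclusion in
  \<open>V\<close> is an equality. Assuming \<open>LR V \<le> 1 / n\<close> instead of tightness
  makes this serve the lower bound for \<open>n\<close> from 14 to 16 as well.\<close>

lemma LR_le_imp_known:
  assumes "4 \<le> n" "n \<le> 16" "speed_set n V" "Gcd V = 1" "\<forall>v\<in>V. v < 2 * n" "LR V \<le> 1 / n"
  shows "V \<in> {baseline n} \<union> exceptional n"
proof -
  obtain S where S: "S \<in> set (general_survivors n)" "set S \<subseteq> V"
    using general_survivors_complete[OF assms(3) _ assms(4-6)] assms(1) by auto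
  note cases = general_survivors_cases[OF assms(1,2) S(1)]
  have "card (set S) = card V"
    using cases(1,2) assms(3) by (auto simp: distinct_card speed_set_def)
  then have "set S = V" using S(2) assms(3) by (intro card_subset_eq) (auto simp: speed_set_def)
  with cases(3) show ?thesis by simp
qed

lemma tight_accelerated_list:
  assumes "list_all (\<lambda>b. gcd r b > 1) [n - r..<m * (n - r)]"
    "2 \<le> r" "r < n" "n \<le> m * r" "\<not> n dvd m * r" "w = m * r"
  shows "tight n ((baseline n - {r}) \<union> {w})"
  unfolding assms(6) by (rule tight_accelerated) (use assms in \<open>auto simp: list_all_iff\<close>)

lemma tight_if_covers:
  assumes "covers n 0 1 L" "fst ` set L \<subseteq> V" "speed_set n V" "n \<ge> 2" "\<forall>v\<in>V. \<not> n dvd v"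
  shows "tight n V"
proof (rule tightI)
  fix t :: real assume "0 \<le> t" "t < 1"
  then show "\<exists>v\<in>V. dist_int (real v * t) \<le> 1 / n"
    using covers_sound[OF assms(1), of t] assms(2,4) by fastforce
qed (use assms in auto)

lemma tight_5: "tight 5 {1, 3, 4, 7}"
proof (rule tight_if_covers)
  \<comment> \<open>The intervals run from left to right and may just touch: those of
    \<open>(3, 1)\<close> and \<open>(7, 3)\<close> share only the point
    \<open>2 / 5\<close>.\<close>
  show "covers 5 0 1 [(1, 0), (4, 1), (3, 1), (7, 3), (4, 2), (7, 4), (3, 2), (4, 3), (1, 1)]"
    by code_simp
qed (code_simp, simp add: speed_set_def, simp, code_simp)

lemma tight_6: "tight 6 {1, 3, 4, 5, 9}"
proof (rule tight_if_covers)
  show "covers 6 0 1 [(1, 0), (5, 1), (4, 1), (3, 1), (5, 2), (9, 4), (4, 2), (9, 5), (5, 3), (3, 2),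
    (4, 3), (5, 4), (1, 1)]"
    by code_simp
qed (code_simp, simp add: speed_set_def, simp, code_simp)

lemma tight_8: "tight 8 {1, 4, 5, 6, 7, 11, 13}"
proof (rule tight_if_covers)
  show "covers 8 0 1 [(1, 0), (7, 1), (6, 1), (5, 1), (4, 1), (7, 2), (13, 4), (6, 2), (11, 4), (5, 2),
    (7, 3), (11, 5), (13, 6), (4, 2), (13, 7), (11, 6), (7, 4), (5, 3), (11, 7), (6, 4), (13, 9), (7, 5),
    (4, 3), (5, 4), (6, 5), (7, 6), (1, 1)]"
    by code_simp
qed (code_simp, simp add: speed_set_def, simp, code_simp)

lemma tight_single:
  assumes "(n, r, w) \<in> tight_replacements"
  shows "tight n ((baseline n - {r}) \<union> {w})"
proof -
  have "baseline 5 - {2} \<union> {7} = {1, 3, 4, 7}" "baseline 6 - {2} \<union> {9} = {1, 3, 4, 5, 9}"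
    by code_simp+
  then have special: "tight 5 (baseline 5 - {2} \<union> {7})" "tight 6 (baseline 6 - {2} \<union> {9})"
    using tight_5 tight_6 by simp_all
  \<comment> \<open>Only in the first two triples is \<open>w\<close> no multiple of
    \<open>r\<close>; elsewhere \<open>m = 2\<close>, except for \<open>m = 3\<close> when
    \<open>w = 90\<close>.\<close>
  have "\<forall>(n, r, w)\<in>tight_replacements. (n, r, w) = (5, 2, 7) \<or> (n, r, w) = (6, 2, 9) \<or>
      (\<exists>m\<in>{2, 3}. list_all (\<lambda>b. gcd r b > 1) [n - r..<m * (n - r)] \<and>
        2 \<le> r \<and> r < n \<and> n \<le> m * r \<and> \<not> n dvd m * r \<and> w = m * r)"
    by code_simp
  from bspec[OF this assms] consider "n = 5" "r = 2" "w = 7" | "n = 6" "r = 2" "w = 9"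
    | m where "list_all (\<lambda>b. gcd r b > 1) [n - r..<m * (n - r)]"
        "2 \<le> r" "r < n" "n \<le> m * r" "\<not> n dvd m * r" "w = m * r"
    unfolding split prod.inject by blast
  then show ?thesis
  proof cases
    case 1
    show ?thesis unfolding 1 by (rule special)
  next
    case 2
    show ?thesis unfolding 2 by (rule special)
  next
    case 3
    then show ?thesis by (rule tight_accelerated_list)
  qed
qed

lemma tight_known:
  assumes "4 \<le> n" "V \<in> {baseline n} \<union> exceptional n"
  shows "tight n V" "Gcd V = 1" "\<forall>v\<in>V. v < 2 * n"
proof -
  have "baseline 8 - {6} \<union> {12} = {1, 2, 3, 4, 5, 7, 12}" "baseline 14 - {12} \<union> {24} = {1..11} \<union> {13, 24}"
    by code_simp+
  then have "tight 8 {1, 2, 3, 4, 5, 7, 12}" "tight 14 ({1..11} \<union> {13, 24})"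
    using tight_single[of 8 6 12] tight_single[of 14 12 24] by (simp_all add: tight_replacements_def)
  then show "tight n V"
    using assms tight_baseline[of n] tight_5 tight_6 tight_8
    by (auto simp: exceptional_def simp del: Un_insert_right split: if_splits)
  have "1 \<in> V" using assms by (auto simp: exceptional_def baseline_def split: if_splits)
  then show "Gcd V = 1" using Gcd_dvd_nat by fastforce
  show "\<forall>v\<in>V. v < 2 * n" using assms by (auto simp: exceptional_def baseline_def split: if_splits)
qed

lemma single_iff:
  assumes "5 \<le> n" "n \<le> 45" "r \<in> baseline n" "n \<le> w" "w \<le> 10 * n"
  shows "tight n ((baseline n - {r}) \<union> {w}) \<longleftrightarrow>
    (n, r, w) \<in> tight_replacements" (is "?L \<longleftrightarrow> ?R")
proof
  assume ?L
  then have LR: "LR ((baseline n - {r}) \<union> {w}) \<le> 1 / n" by (simp add: tight_def)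
  have "2 \<le> n" using assms(1) by simp
  from all_single_survivors_complete[OF this assms(3-5) LR]
  obtain S where S: "(n, r, S) \<in> set (all_single_survivors n)" "set S \<subseteq> {w}" .
  from all_single_survivors_cases[OF assms(1,2) S(1)] S(2) show ?R by auto
qed (rule tight_single)

lemma doubleton_eqI: "a \<in> {x, y} \<Longrightarrow> b \<in> {x, y} \<Longrightarrow> a \<noteq> b \<Longrightarrow> {x, y} = {a, b}"
  by auto

lemma pair_tight_imp:
  assumes "6 \<le> n" "n \<le> 34" "r1 \<in> baseline n" "r2 \<in> baseline n" "r1 \<noteq> r2"
    and "n \<le> w1" "w1 \<le> 4 * n" "n \<le> w2" "w2 \<le> 4 * n"
    and "tight n ((baseline n - {r1, r2}) \<union> {w1, w2})"
  shows "n = 8 \<and> (baseline n - {r1, r2}) \<union> {w1, w2} = {1, 4, 5, 6, 7, 11, 13}"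
  using assms(3-5,10)
proof (induction r1 r2 rule: linorder_wlog)
  case (le r1 r2)
  let ?V = "(baseline n - {r1, r2}) \<union> {w1, w2}"
  have LR: "LR ?V \<le> 1 / n" using le.prems by (simp add: tight_def)
  have "r1 < r2" using le by simp
  have "4 \<le> n" using assms(1) by simp
  from all_pair_survivors_complete[OF this le.prems(1,2) \<open>r1 < r2\<close> assms(6-9) LR]
  obtain S where S: "(n, r1, r2, S) \<in> set (all_pair_survivors n)" "set S \<subseteq> {w1, w2}" .
  have doubleton: "{w1, w2} = {a, b}" if "S = [a, b]" "a \<noteq> b" for a b
    using S(2) that by (intro doubleton_eqI) simp_all
  consider "n = 7" "r1 = 2" "r2 = 6" "S = [13, 18]" | "n = 8" "r1 = 2" "r2 = 3" "S = [13, 11]"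
    | "n = 11" "r1 = 4" "r2 = 10" "S = [42, 30]"
    using all_pair_survivors_cases[OF assms(1,2) S(1)] by blast
  then consider "n = 7" "?V = {1, 3, 4, 5, 13, 18}" | "n = 8" "?V = {1, 4, 5, 6, 7, 11, 13}"
    | "n = 11" "?V = {1, 2, 3, 5, 6, 7, 8, 9, 30, 42}"
  proof cases
    case 1
    have "?V = {1, 3, 4, 5, 13, 18}"
      unfolding 1(1-3) by (subst doubleton[OF 1(4)], simp, code_simp)
    then show ?thesis by (rule that(1)[OF 1(1)])
  next
    case 2
    have "?V = {1, 4, 5, 6, 7, 11, 13}"
      unfolding 2(1-3) by (subst doubleton[OF 2(4)], simp, code_simp)
    then show ?thesis by (rule that(2)[OF 2(1)])
  next
    case 3
    have "?V = {1, 2, 3, 5, 6, 7, 8, 9, 30, 42}"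
      unfolding 3(1-3) by (subst doubleton[OF 3(4)], simp, code_simp)
    then show ?thesis by (rule that(3)[OF 3(1)])
  qed
  then show ?case
  proof cases
    case 1
    \<comment> \<open>The time behind this pair is \<open>10 / 23\<close>, as \<open>7 * 10\<close>
      is 1 modulo 23: no speed is congruent to 0, 7, 14, 21 or their negatives.\<close>
    have "1 / real 7 < LR {1, 3, 4, 5, 13, 18}"
    proof (rule not_blocked_imp_LR_gt)
      show "set (blockers 7 18 23 7) \<inter> {1, 3, 4, 5, 13, 18} = {}" by code_simp
      show "coprime 7 (23 :: nat)" by (simp add: coprime_iff_gcd_eq_1 gcd_nat.simps)
    qed auto
    then show ?thesis using LR 1 by simp
  next
    case 3
    \<comment> \<open>Here the time is \<open>27 / 37\<close>, as \<open>11 * 27\<close> is 1 modulo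
      37: no speed is congruent to 0, 11, 22, 33 or their negatives.\<close>
    have "1 / real 11 < LR {1, 2, 3, 5, 6, 7, 8, 9, 30, 42}"
    proof (rule not_blocked_imp_LR_gt)
      show "set (blockers 11 42 37 11) \<inter> {1, 2, 3, 5, 6, 7, 8, 9, 30, 42} = {}" by code_simp
      show "coprime 11 (37 :: nat)" by (simp add: coprime_iff_gcd_eq_1 gcd_nat.simps)
    qed auto
    then show ?thesis using LR 3 by simp
  qed simp
next
  case (sym r1 r2)
  have "{r2, r1} = {r1, r2}" by auto
  from sym[unfolded this] show ?case by blast
qed

lemma eight_iff:
  assumes "r1 \<in> baseline 8" "r2 \<in> baseline 8" "8 \<le> w1" "8 \<le> w2"
  shows "(baseline 8 - {r1, r2}) \<union> {w1, w2} = {1, 4, 5, 6, 7, 11, 13} \<longleftrightarrow>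
    {r1, r2} = {2, 3} \<and> {w1, w2} = {11, 13}" (is "?V = ?S \<longleftrightarrow> _")
proof
  have b: "baseline 8 = {1, 2, 3, 4, 5, 6, 7}" by code_simp
  assume V: "?V = ?S"
  have "{r1, r2} = {2, 3}" "{w1, w2} = {11, 13}"
  proof -
    have "2 \<notin> ?V" "3 \<notin> ?V" "11 \<in> ?V" "13 \<in> ?V" unfolding V by auto
    then have mem: "2 \<in> {r1, r2}" "3 \<in> {r1, r2}" "11 \<in> {w1, w2}" "13 \<in> {w1, w2}"
      unfolding b by auto
    show "{r1, r2} = {2, 3}" by (rule doubleton_eqI[OF mem(1,2)]) simp
    show "{w1, w2} = {11, 13}" by (rule doubleton_eqI[OF mem(3,4)]) simp
  qed
  then show "{r1, r2} = {2, 3} \<and> {w1, w2} = {11, 13}" ..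
next
  assume *: "{r1, r2} = {2, 3} \<and> {w1, w2} = {11, 13}"
  show "?V = ?S" unfolding *[THEN conjunct1] *[THEN conjunct2] by code_simp
qed

text \<open>In this set 6 is the only multiple of 3 and the only multiple of 6, so 3 and 6 would
  have the same image.\<close>

lemma not_accelerated: "\<not> accelerated_baseline 8 {1, 4, 5, 6, 7, 11, 13}"
proof
  assume "accelerated_baseline 8 {1, 4, 5, 6, 7, 11, 13}"
  then obtain f where f: "bij_betw f (baseline 8) {1, 4, 5, 6, 7, 11, 13}" "\<forall>v\<in>baseline 8. v dvd f v"
    unfolding accelerated_baseline_def by blast
  have V: "f v \<in> {1, 4, 5, 6, 7, 11, 13}" "v dvd f v" if "v \<in> baseline 8" for v
    using that f(2) bij_betwE[OF f(1)] by blast+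
  have "f 3 = 6" using V[of 3] by (auto simp: baseline_def)
  moreover have "f 6 = 6" using V[of 6] by (auto simp: baseline_def)
  ultimately show False
    using bij_betw_imp_inj_on[OF f(1)] by (auto simp: baseline_def dest: inj_onD[of _ _ 3 6])
qed

theorem theorem1p8:
  shows
    "(\<forall>n r w :: nat. 5 \<le> n \<and> n \<le> 45 \<and> r \<in> baseline n \<and> n \<le> w \<and> w \<le> 10 * n \<and>
        Gcd ((baseline n - {r}) \<union> {w}) = 1 \<longrightarrow>
        (tight n ((baseline n - {r}) \<union> {w}) \<longleftrightarrow>
          (n, r, w) \<in> {(5, 2, 7), (6, 2, 9), (8, 6, 12), (14, 12, 24), (20, 18, 36), (26, 24, 48),
            (32, 30, 60), (32, 30, 90), (33, 30, 60), (38, 36, 72), (44, 42, 84)})) \<and>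
     (\<forall>(n, r, w) \<in> {(8, 6, 12), (14, 12, 24), (20, 18, 36), (26, 24, 48), (32, 30, 60),
          (32, 30, 90), (33, 30, 60), (38, 36, 72), (44, 42, 84 :: nat)} :: (nat \<times> nat \<times> nat) set.
        \<exists>m\<ge>2. w = m * r \<and> (let s = n - r in \<forall>b\<in>{s..m * s - 1}. gcd r b > 1)) \<and>
     {(n :: nat, V). 6 \<le> n \<and> n \<le> 34 \<and> Gcd V = 1 \<and> tight n V \<and>
        (\<exists>r1 r2 w1 w2. r1 \<in> baseline n \<and> r2 \<in> baseline n \<and> r1 \<noteq> r2 \<and> w1 \<noteq> w2 \<and>
           n - 1 < w1 \<and> w1 \<le> 4 * n \<and> n - 1 < w2 \<and> w2 \<le> 4 * n \<and>
           V = (baseline n - {r1, r2}) \<union> {w1, w2})}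
       = {(8, {1, 4, 5, 6, 7, 11, 13})} \<and>
     (\<forall>r1 r2 w1 w2 :: nat. r1 \<in> baseline 8 \<and> r2 \<in> baseline 8 \<and> r1 \<noteq> r2 \<and> w1 \<noteq> w2 \<and>
        8 - 1 < w1 \<and> w1 \<le> 4 * 8 \<and> 8 - 1 < w2 \<and> w2 \<le> 4 * 8 \<longrightarrow>
        ((baseline 8 - {r1, r2}) \<union> {w1, w2} = {1, 4, 5, 6, 7, 11, 13} \<longleftrightarrow>
          {r1, r2} = {2, 3} \<and> {w1, w2} = {11, 13})) \<and>
     \<not> accelerated_baseline 8 {1, 4, 5, 6, 7, 11, 13} \<and>
     (\<forall>w\<in>{11, 13 :: nat}. \<not> 2 dvd w \<and> \<not> 3 dvd w) \<and>
     (\<forall>n :: nat. 4 \<le> n \<and> n \<le> 16 \<longrightarrow>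
        {V. Gcd V = 1 \<and> (\<forall>v\<in>V. v < 2 * n) \<and> tight n V} =
          {baseline n} \<union>
          (if n = 5 then {{1, 3, 4, 7}}
           else if n = 6 then {{1, 3, 4, 5, 9}}
           else if n = 8 then {{1, 2, 3, 4, 5, 7, 12}, {1, 4, 5, 6, 7, 11, 13}}
           else if n = 14 then {{1..11} \<union> {13, 24}}
           else {})) \<and>
     (\<forall>n\<in>{14, 15, 16 :: nat}. \<forall>V. speed_set n V \<and> Gcd V = 1 \<and> (\<forall>v\<in>V. v \<le> 2 * n - 1) \<longrightarrow>
        LR V \<ge> 1 / real n)"
proof (intro conjI)
  show "\<forall>n r w :: nat. 5 \<le> n \<and> n \<le> 45 \<and> r \<in> baseline n \<and> n \<le> w \<and> w \<le> 10 * n \<and>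
        Gcd ((baseline n - {r}) \<union> {w}) = 1 \<longrightarrow>
        (tight n ((baseline n - {r}) \<union> {w}) \<longleftrightarrow>
          (n, r, w) \<in> {(5, 2, 7), (6, 2, 9), (8, 6, 12), (14, 12, 24), (20, 18, 36), (26, 24, 48),
            (32, 30, 60), (32, 30, 90), (33, 30, 60), (38, 36, 72), (44, 42, 84)})"
    unfolding tight_replacements_def[symmetric] by (intro allI impI, elim conjE) (rule single_iff)
  show "\<forall>(n, r, w) \<in> {(8, 6, 12), (14, 12, 24), (20, 18, 36), (26, 24, 48), (32, 30, 60),
          (32, 30, 90), (33, 30, 60), (38, 36, 72), (44, 42, 84 :: nat)} :: (nat \<times> nat \<times> nat) set.
        \<exists>m\<ge>2. w = m * r \<and> (let s = n - r in \<forall>b\<in>{s..m * s - 1}. gcd r b > 1)"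
  proof -
    \<comment> \<open>Seven triples have \<open>s = 2\<close> and \<open>m = 2\<close>. The bound 5
      belongs to \<open>(32, 30, 90)\<close> with \<open>m = 3\<close> and to
      \<open>(33, 30, 60)\<close> with \<open>s = 3\<close>.\<close>
    have "\<forall>r\<in>{6, 12, 18, 24, 30, 36, 42 :: nat}. \<forall>b\<in>{2..3}. gcd r b > 1" by code_simp
    moreover have "\<forall>b\<in>{2..5 :: nat}. gcd 30 b > 1" "\<forall>b\<in>{3..5 :: nat}. gcd 30 b > 1" by code_simp+
    ultimately show ?thesis by (auto simp: Let_def)
  qed
  show "{(n :: nat, V). 6 \<le> n \<and> n \<le> 34 \<and> Gcd V = 1 \<and> tight n V \<and>
        (\<exists>r1 r2 w1 w2. r1 \<in> baseline n \<and> r2 \<in> baseline n \<and> r1 \<noteq> r2 \<and> w1 \<noteq> w2 \<and>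
           n - 1 < w1 \<and> w1 \<le> 4 * n \<and> n - 1 < w2 \<and> w2 \<le> 4 * n \<and>
           V = (baseline n - {r1, r2}) \<union> {w1, w2})}
       = {(8, {1, 4, 5, 6, 7, 11, 13})}" (is "?A = ?B")
  proof
    show "?A \<subseteq> ?B"
    proof (rule subrelI)
      fix n V assume "(n, V) \<in> ?A"
      then obtain r1 r2 w1 w2 where *: "6 \<le> n" "n \<le> 34" "r1 \<in> baseline n" "r2 \<in> baseline n" "r1 \<noteq> r2"
          "n - 1 < w1" "w1 \<le> 4 * n" "n - 1 < w2" "w2 \<le> 4 * n"
          "tight n V" "V = (baseline n - {r1, r2}) \<union> {w1, w2}"
        unfolding mem_Collect_eq split by blast
      have "n \<le> w1" "n \<le> w2" using *(6,8) by simp_all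
      with * have "n = 8 \<and> V = {1, 4, 5, 6, 7, 11, 13}"
        using pair_tight_imp[OF *(1-5) _ *(7) _ *(9)] by blast
      then show "(n, V) \<in> ?B" by blast
    qed
    have "\<exists>r1 r2 w1 w2. r1 \<in> baseline 8 \<and> r2 \<in> baseline 8 \<and> r1 \<noteq> r2 \<and> w1 \<noteq> w2 \<and>
        8 - 1 < w1 \<and> w1 \<le> 4 * 8 \<and> 8 - 1 < w2 \<and> w2 \<le> 4 * 8 \<and>
        {1, 4, 5, 6, 7, 11, 13 :: nat} = (baseline 8 - {r1, r2}) \<union> {w1, w2}"
      by (rule exI[of _ 2], rule exI[of _ 3], rule exI[of _ 11], rule exI[of _ 13], code_simp)
    moreover have "6 \<le> (8 :: nat)" "(8 :: nat) \<le> 34" "Gcd {1, 4, 5, 6, 7, 11, 13 :: nat} = 1"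
      by code_simp+
    ultimately have "(8, {1, 4, 5, 6, 7, 11, 13}) \<in> ?A"
      unfolding mem_Collect_eq split by (intro conjI tight_8)
    then show "?B \<subseteq> ?A" by (intro insert_subsetI empty_subsetI)
  qed
  show "\<forall>r1 r2 w1 w2 :: nat. r1 \<in> baseline 8 \<and> r2 \<in> baseline 8 \<and> r1 \<noteq> r2 \<and> w1 \<noteq> w2 \<and>
        8 - 1 < w1 \<and> w1 \<le> 4 * 8 \<and> 8 - 1 < w2 \<and> w2 \<le> 4 * 8 \<longrightarrow>
        ((baseline 8 - {r1, r2}) \<union> {w1, w2} = {1, 4, 5, 6, 7, 11, 13} \<longleftrightarrow>
          {r1, r2} = {2, 3} \<and> {w1, w2} = {11, 13})"
    by (intro allI impI eight_iff) auto
  show "\<forall>n :: nat. 4 \<le> n \<and> n \<le> 16 \<longrightarrow>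
        {V. Gcd V = 1 \<and> (\<forall>v\<in>V. v < 2 * n) \<and> tight n V} =
          {baseline n} \<union>
          (if n = 5 then {{1, 3, 4, 7}}
           else if n = 6 then {{1, 3, 4, 5, 9}}
           else if n = 8 then {{1, 2, 3, 4, 5, 7, 12}, {1, 4, 5, 6, 7, 11, 13}}
           else if n = 14 then {{1..11} \<union> {13, 24}}
           else {})"
    unfolding exceptional_def[symmetric]
  proof (intro allI impI set_eqI iffI)
    fix n V assume "4 \<le> n \<and> n \<le> (16 :: nat)" "V \<in> {V. Gcd V = 1 \<and> (\<forall>v\<in>V. v < 2 * n) \<and> tight n V}"
    then show "V \<in> {baseline n} \<union> exceptional n" by (intro LR_le_imp_known) (auto simp: tight_def)
  next
    fix n V assume "4 \<le> n \<and> n \<le> (16 :: nat)" "V \<in> {baseline n} \<union> exceptional n"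
    then show "V \<in> {V. Gcd V = 1 \<and> (\<forall>v\<in>V. v < 2 * n) \<and> tight n V}" using tight_known[of n V] by auto
  qed
  show "\<forall>n\<in>{14, 15, 16 :: nat}. \<forall>V. speed_set n V \<and> Gcd V = 1 \<and> (\<forall>v\<in>V. v \<le> 2 * n - 1) \<longrightarrow>
        LR V \<ge> 1 / real n"
  proof (intro ballI allI impI)
    fix n V assume n: "n \<in> {14, 15, 16 :: nat}"
      and V: "speed_set n V \<and> Gcd V = 1 \<and> (\<forall>v\<in>V. v \<le> 2 * n - 1)"
    show "LR V \<ge> 1 / real n"
    proof (cases "LR V \<le> 1 / real n")
      case True
      then have "V \<in> {baseline n} \<union> exceptional n" using n V by (intro LR_le_imp_known) auto
      then show ?thesis using tight_known(1)[of n V] n by (auto simp: tight_def)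
    qed simp
  qed
qed (use not_accelerated in auto)

end
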